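(* For every integer $n\geq 2$, the multipath complex $X(\mathtt{BP}_n)$ of the bidirectional polygonal digraph $\mathtt{BP}_n$ on $n+1$ vertices is not shellable.
   Context: A digraph has at most one edge $(v,w)$ from $v$ to $w$ for each ordered pair of vertices. For an edge $e=(v,w)$, $s(e)=v$ is its source and $t(e)=w$ its target. A simple path in a digraph is a sequence of edges $e_1,\dots,e_k$ with $s(e_{i+1})=t(e_i)$ for all $i<k$, such that $s(e_i)=s(e_j)$ or $t(e_i)=t(e_j)$ implies $i=j$, and which is not a cycle, i.e. $s(e_1)\neq t(e_k)$. A multipath of a digraph $G$ is a spanning subgraph each of whose connected components is either a single vertex or a simple path. The multipath complex $X(G)$ is the (abstract) simplicial complex whose simplices are the nonempty edge sets of multipaths of $G$ (the empty simplex corresponds to the multipath with no edges). The bidirectional polygonal digraph $\mathtt{BP}_n$ has $n+1$ vertices $0,1,\dots,n$ and the $2n+2$ edges $(i,i+1)$ and $(i+1,i)$, with $i$ taken modulo $n+1$. Shellability is meant in the general (not necessarily pure) sense: a finite simplicial complex is shellable if its maximal faces can be ordered $F_1,\dots,F_k$ so that for every $2\le x\le k$ the subcomplex $\langle F_x\rangle\cap\bigcup_{i<x}\langle F_i\rangle$ is pure of dimension $\dim F_x-1$, where $\langle F\rangle$ denotes the complex of all faces of $F$. *)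

theory Defs
  imports "Graph_Theory.Digraph_Component"
begin

section \<open>Multipath complexes\<close>

definition simple_path :: "('a, 'b) pre_digraph \<Rightarrow> 'b list \<Rightarrow> bool" where
  "simple_path G es \<longleftrightarrow>
     es \<noteq> [] \<and> set es \<subseteq> arcs G \<and>
     (\<forall>i. Suc i < length es \<longrightarrow> tail G (es ! Suc i) = head G (es ! i)) \<and>
     (\<forall>i < length es. \<forall>j < length es.
        tail G (es ! i) = tail G (es ! j) \<or> head G (es ! i) = head G (es ! j) \<longrightarrow> i = j) \<and>
     tail G (hd es) \<noteq> head G (last es)"

definition is_single_vertex :: "('a, 'b) pre_digraph \<Rightarrow> bool" where
  "is_single_vertex C \<longleftrightarrow> (\<exists>v. verts C = {v}) \<and> arcs C = {}"

definition is_simple_path :: "('a, 'b) pre_digraph \<Rightarrow> bool" where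
  "is_simple_path C \<longleftrightarrow>
     (\<exists>es. simple_path C es \<and> arcs C = set es \<and> verts C = tail C ` set es \<union> head C ` set es)"

text \<open>
  Connectivity is that of the underlying undirected graph: \<^const>\<open>connected\<close> symmetrises the arcs,
  and a connected component is a maximal connected subgraph.
\<close>

definition multipath :: "('a, 'b) pre_digraph \<Rightarrow> ('a, 'b) pre_digraph \<Rightarrow> bool" where
  "multipath G H \<longleftrightarrow>
     spanning H G \<and>
     (\<forall>C. pre_digraph.max_subgraph H connected C \<longrightarrow> is_single_vertex C \<or> is_simple_path C)"

text \<open>
  A simplicial complex is given by the set of its faces, the empty face included (it has
  dimension \<open>-1\<close> and corresponds here to the multipath without arcs).
\<close>

definition multipath_complex :: "('a, 'b) pre_digraph \<Rightarrow> 'b set set" where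
  "multipath_complex G = {arcs H | H. multipath G H}"

section \<open>Shellability\<close>

definition facets :: "'v set set \<Rightarrow> 'v set set" where
  "facets K = {F \<in> K. \<forall>F' \<in> K. F \<subseteq> F' \<longrightarrow> F' = F}"

definition face_dim :: "'v set \<Rightarrow> int" where
  "face_dim F = int (card F) - 1"

definition pure_of_dim :: "'v set set \<Rightarrow> int \<Rightarrow> bool" where
  "pure_of_dim K d \<longleftrightarrow> (\<forall>F \<in> facets K. face_dim F = d)"

text \<open>
  The facets are numbered from 0. Because the empty face belongs to every complex, a 0-dimensional
  facet meets the preceding ones in \<open>{{}}\<close>, which is pure of dimension \<open>-1\<close> as required.
\<close>

definition shellable :: "'v set set \<Rightarrow> bool" where
  "shellable K \<longleftrightarrow>
     (\<exists>Fs. distinct Fs \<and> set Fs = facets K \<and>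
        (\<forall>x. 0 < x \<and> x < length Fs \<longrightarrow>
           pure_of_dim (Pow (Fs ! x) \<inter> (\<Union>i<x. Pow (Fs ! i))) (face_dim (Fs ! x) - 1)))"

section \<open>Bidirectional polygonal digraphs\<close>

definition BP :: "nat \<Rightarrow> nat pair_pre_digraph" where
  "BP n = \<lparr> pverts = {0..n},
            parcs = {(i, (i + 1) mod (n + 1)) | i. i \<le> n} \<union> {((i + 1) mod (n + 1), i) | i. i \<le> n} \<rparr>"

end

theory Submission
  imports Defs
begin

text \<open>
  The clockwise arcs and the anticlockwise arcs of \<open>BP n\<close> each form a directed cycle, and deleting
  one arc from such a cycle leaves a facet. A face containing an arc of one cycle omits at least
  three arcs of the other, since \<open>(i, i+1)\<close> excludes \<open>(i+1, i)\<close> and the two reverse arcs that have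
  the same source or the same target. Consequently a facet sharing all but one vertex with a facet
  \<open>B - {b}\<close> of one cycle \<open>B\<close> is again of this form, so the earliest facet of this form cannot be
  preceded by anything in a shelling. This applies to both cycles, but only one facet can come first.
\<close>

section \<open>Two disjoint boundary spheres obstruct shellability\<close>

text \<open>Missing at most two elements of \<open>B\<close>, the facet avoids \<open>A\<close> by
  \<open>far\<close>. It then lies in some \<open>B - {b}\<close>, and maximality gives
  equality.\<close>

lemma facet_card_diff_le_2:
  assumes B: "finite B"
    and del: "\<And>x. x \<in> B \<Longrightarrow> B - {x} \<in> K"
    and sub: "\<And>F. F \<in> K \<Longrightarrow> F \<subseteq> A \<union> B \<and> \<not> B \<subseteq> F"
    and far: "\<And>F. F \<in> K \<Longrightarrow> F \<inter> A \<noteq> {} \<Longrightarrow> 3 \<le> card (B - F)"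
    and F: "F \<in> facets K" "card (B - F) \<le> 2"
  shows "\<exists>b\<in>B. F = B - {b}"
proof -
  have FK: "F \<in> K" using F(1) by (simp add: facets_def)
  have "F \<inter> A = {}" using far[OF FK] F(2) by fastforce
  then have "F \<subseteq> B" using sub[OF FK] by blast
  moreover obtain b where b: "b \<in> B" "b \<notin> F" using sub[OF FK] by blast
  ultimately have "F \<subseteq> B - {b}" by blast
  then have "B - {b} = F" using F(1) del[OF b(1)] by (simp add: facets_def)
  then show ?thesis using b by blast
qed

text \<open>A face containing \<open>B - {b}\<close> misses at most one element of \<open>B\<close>,
  so it avoids \<open>A\<close> by \<open>far\<close>; as a proper subset of \<open>B\<close> it is
  \<open>B - {b}\<close>.\<close>

lemma punctured_in_facets:
  assumes B: "finite B"
    and del: "\<And>x. x \<in> B \<Longrightarrow> B - {x} \<in> K"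
    and sub: "\<And>F. F \<in> K \<Longrightarrow> F \<subseteq> A \<union> B \<and> \<not> B \<subseteq> F"
    and far: "\<And>F. F \<in> K \<Longrightarrow> F \<inter> A \<noteq> {} \<Longrightarrow> 3 \<le> card (B - F)"
    and b: "b \<in> B"
  shows "B - {b} \<in> facets K"
proof -
  have "F = B - {b}" if F: "F \<in> K" "B - {b} \<subseteq> F" for F
  proof -
    have "card (B - F) \<le> card {b}" using F(2) by (intro card_mono) auto
    then have "F \<inter> A = {}" using far[OF F(1)] by fastforce
    then show ?thesis using sub[OF F(1)] F(2) by blast
  qed
  then show ?thesis using del[OF b] by (auto simp: facets_def)
qed

text \<open>Consider the earliest facet of the form \<open>B - {b}\<close>. At a positive position,
  purity would place a ridge of it inside an earlier facet, which by
  \<open>facet_card_diff_le_2\<close> would have the same form.\<close>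

lemma shelling_starts_with_punctured:
  assumes B: "finite B" "B \<noteq> {}"
    and del: "\<And>x. x \<in> B \<Longrightarrow> B - {x} \<in> K"
    and sub: "\<And>F. F \<in> K \<Longrightarrow> F \<subseteq> A \<union> B \<and> \<not> B \<subseteq> F"
    and far: "\<And>F. F \<in> K \<Longrightarrow> F \<inter> A \<noteq> {} \<Longrightarrow> 3 \<le> card (B - F)"
    and Fs: "set Fs = facets K"
    and pure: "\<And>x. 0 < x \<Longrightarrow> x < length Fs \<Longrightarrow>
      pure_of_dim (Pow (Fs ! x) \<inter> (\<Union>i<x. Pow (Fs ! i))) (face_dim (Fs ! x) - 1)"
  shows "\<exists>b\<in>B. Fs ! 0 = B - {b}"
proof -
  define P where "P x \<longleftrightarrow> x < length Fs \<and> (\<exists>b\<in>B. Fs ! x = B - {b})" for x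
  obtain b0 where "b0 \<in> B" using B by blast
  then have "B - {b0} \<in> set Fs"
    unfolding Fs by (intro punctured_in_facets[OF B(1) del sub far])
  then have "\<exists>x. P x" using \<open>b0 \<in> B\<close> by (auto simp: in_set_conv_nth P_def)
  define x where "x = (LEAST x. P x)"
  have Px: "P x" and least: "\<And>y. y < x \<Longrightarrow> \<not> P y"
    using LeastI_ex[OF \<open>\<exists>x. P x\<close>] not_less_Least by (auto simp: x_def)
  obtain b where b: "b \<in> B" "Fs ! x = B - {b}" and xl: "x < length Fs"
    using Px by (auto simp: P_def)
  have "x = 0"
  proof (rule ccontr)
    assume "x \<noteq> 0"
    then have x0: "0 < x" by simp
    let ?C = "Pow (Fs ! x) \<inter> (\<Union>i<x. Pow (Fs ! i))"
    \<comment> \<open>The empty face lies in every \<open>Pow\<close>, so \<open>0 < x\<close> makes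
      the intersection nonempty and a maximal face exists.\<close>
    have C: "finite ?C" "?C \<noteq> {}" using b B x0 by auto
    obtain M where M: "M \<in> ?C" "\<forall>N\<in>?C. M \<subseteq> N \<longrightarrow> M = N"
      using finite_has_maximal[OF C] by (elim bexE) (rule that)
    have "M \<in> facets ?C" using M unfolding facets_def by blast
    then have "face_dim M = face_dim (B - {b}) - 1"
      using pure[OF x0 xl] b(2) by (simp add: pure_of_dim_def)
    \<comment> \<open>One element of \<open>B\<close> is lost in \<open>B - {b}\<close> and one more
      by purity. The additive form avoids truncated subtraction.\<close>
    then have cM: "card B \<le> card M + 2"
      using b B by (simp add: face_dim_def)
    obtain i where i: "i < x" "M \<subseteq> Fs ! i" and MB: "M \<subseteq> B" using M(1) b by auto
    have "card (B - Fs ! i) \<le> card (B - M)" using i B by (intro card_mono) auto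
    also have "\<dots> = card B - card M" using MB B by (intro card_Diff_subset) (auto intro: finite_subset)
    finally have "card (B - Fs ! i) \<le> 2" using cM by simp
    moreover have "Fs ! i \<in> facets K" using i xl Fs nth_mem[of i Fs] by simp
    ultimately have "P i"
      using facet_card_diff_le_2[OF B(1) del sub far] i xl by (simp add: P_def)
    then show False using least[OF i(1)] by simp
  qed
  then show ?thesis using b by auto
qed

text \<open>The sets \<open>B - {b}\<close> are the facets of the boundary sphere of the simplex on
  \<open>B\<close>, and likewise for \<open>A\<close>. Each sphere claims the first facet of a
  shelling, but disjoint sets with at least two elements share no such facet.\<close>

lemma not_shellable_two_spheres:
  assumes A: "finite A" "2 \<le> card A" and B: "finite B" "2 \<le> card B" and AB: "A \<inter> B = {}"
    and del: "\<And>x. x \<in> A \<Longrightarrow> A - {x} \<in> K" "\<And>x. x \<in> B \<Longrightarrow> B - {x} \<in> K"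
    and sub: "\<And>F. F \<in> K \<Longrightarrow> F \<subseteq> A \<union> B \<and> \<not> A \<subseteq> F \<and> \<not> B \<subseteq> F"
    and far: "\<And>F. F \<in> K \<Longrightarrow> F \<inter> A \<noteq> {} \<Longrightarrow> 3 \<le> card (B - F)"
      "\<And>F. F \<in> K \<Longrightarrow> F \<inter> B \<noteq> {} \<Longrightarrow> 3 \<le> card (A - F)"
  shows "\<not> shellable K"
proof
  assume "shellable K"
  then obtain Fs where Fs: "set Fs = facets K"
    and pure: "\<And>x. 0 < x \<Longrightarrow> x < length Fs \<Longrightarrow>
      pure_of_dim (Pow (Fs ! x) \<inter> (\<Union>i<x. Pow (Fs ! i))) (face_dim (Fs ! x) - 1)"
    unfolding shellable_def by auto
  have "\<exists>b\<in>B. Fs ! 0 = B - {b}"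
    using B(2) sub
    by (intro shelling_starts_with_punctured[OF B(1) _ del(2) _ far(1) Fs pure]) auto
  moreover have "\<exists>a\<in>A. Fs ! 0 = A - {a}"
    using A(2) sub
    by (intro shelling_starts_with_punctured[OF A(1) _ del(1) _ far(2) Fs pure, of B]) auto
  ultimately obtain a b where ab: "a \<in> A" "A - {a} = B - {b}" by metis
  then have "A - {a} = {}" using AB by blast
  then have "card A \<le> 1" using ab(1) A(1) by (metis card_Diff_singleton diff_is_0_eq card.empty)
  then show False using A(2) by simp
qed

section \<open>Faces of multipath complexes\<close>

text \<open>Every \<open>v i\<close> is joined to \<open>v 0\<close> both ways in the symmetric
  closure, so arcs of either orientation may serve as steps and vertices may repeat.\<close>

lemma connected_trail:
  assumes "wf_digraph K" and verts: "verts K = v ` {..k::nat}"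
    and adj: "\<And>i. i < k \<Longrightarrow> \<exists>e\<in>arcs K. (tail K e, head K e) \<in> {(v i, v (Suc i)), (v (Suc i), v i)}"
  shows "connected K"
proof -
  interpret wf_digraph K by fact
  interpret S: pair_wf_digraph "mk_symmetric K" ..
  have step: "(v i, v (Suc i)) \<in> parcs (mk_symmetric K) \<and> (v (Suc i), v i) \<in> parcs (mk_symmetric K)"
    if "i < k" for i
    using adj[OF that] by (force simp: parcs_mk_symmetric)
  have *: "v 0 \<rightarrow>\<^sup>*\<^bsub>mk_symmetric K\<^esub> v i \<and> v i \<rightarrow>\<^sup>*\<^bsub>mk_symmetric K\<^esub> v 0" if "i \<le> k" for i
    using that
  proof (induction i)
    case 0
    then show ?case using verts by (auto intro!: S.reachable_refl)
  next
    case (Suc i)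
    then have "v i \<rightarrow>\<^sup>*\<^bsub>mk_symmetric K\<^esub> v (Suc i)" "v (Suc i) \<rightarrow>\<^sup>*\<^bsub>mk_symmetric K\<^esub> v i"
      using step[of i] by (auto intro!: S.reachable_adjI)
    then show ?case using Suc by (auto intro: S.reachable_trans)
  qed
  show ?thesis unfolding connected_def
  proof (rule strongly_connectedI)
    fix x y assume "x \<in> verts (mk_symmetric K)" "y \<in> verts (mk_symmetric K)"
    then obtain i j where "x = v i" "i \<le> k" "y = v j" "j \<le> k" using verts by auto
    then show "x \<rightarrow>\<^sup>*\<^bsub>mk_symmetric K\<^esub> y"
      using *[of i] *[of j] by (blast intro: S.reachable_trans)
  qed (use verts in auto)
qed

text \<open>Among the connected subgraphs containing \<open>K\<close>, one with the most vertices
  plus arcs is maximal. It is the component to which the definition of \<open>multipath\<close>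
  applies.\<close>

lemma (in fin_digraph) ex_max_connected_supergraph:
  assumes K: "subgraph K G" "connected K"
  obtains C where "max_subgraph connected C" "subgraph K C"
proof -
  let ?P = "\<lambda>C. subgraph C G \<and> connected C \<and> subgraph K C"
  let ?f = "\<lambda>C :: ('a, 'b) pre_digraph. card (verts C) + card (arcs C)"
  have "?P K" using K wf_digraph.subgraph_refl by blast
  moreover have "?f C < card (verts G) + card (arcs G) + 1" if "?P C" for C
  proof -
    have "card (verts C) \<le> card (verts G)" "card (arcs C) \<le> card (arcs G)"
      using that by (auto intro!: card_mono)
    then show ?thesis by simp
  qed
  ultimately obtain C where C: "?P C" and max: "\<And>D. ?P D \<Longrightarrow> ?f D \<le> ?f C"
    using ex_has_greatest_nat[of ?P K ?f] by blast
  have "\<not> (subgraph D G \<and> connected D)" if D: "D \<noteq> C" "subgraph C D" for D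
  proof
    assume DG: "subgraph D G \<and> connected D"
    then have fin: "finite (verts D)" "finite (arcs D)"
      by (auto intro: finite_subset[OF _ finite_verts] finite_subset[OF _ finite_arcs])
    have "?f D \<le> ?f C" using max C DG D(2) subgraph_trans by blast
    moreover have "card (verts C) \<le> card (verts D)" "card (arcs C) \<le> card (arcs D)"
      using D(2) fin by (auto intro!: card_mono)
    ultimately have "card (verts C) = card (verts D)" "card (arcs C) = card (arcs D)" by auto
    then have "verts C = verts D" "arcs C = arcs D"
      using D(2) fin by (metis card_subset_eq subgraphE)+
    moreover have "tail C = tail D" "head C = head D"
      using D(2) by (auto simp: subgraph_def compatible_def)
    ultimately have "C = D" by simp
    then show False using D(1) by simp
  qed
  then have "max_subgraph connected C" using C by (auto simp: max_subgraph_def)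
  then show thesis using that C by blast
qed

section \<open>Connected arc sets and cycles within a face\<close>

context fin_digraph
begin

text \<open>The arcs of \<open>S\<close> with their end points form a connected subgraph of the
  multipath, hence lie in one component. That component has an arc, so it is a simple path.\<close>

lemma connected_arcs_in_simple_path:
  assumes F: "F \<in> multipath_complex G"
    and S: "S \<subseteq> F" "S \<noteq> {}" "tail G ` S \<union> head G ` S = v ` {..k::nat}"
    and adj: "\<And>i. i < k \<Longrightarrow> \<exists>e\<in>S. (tail G e, head G e) \<in> {(v i, v (Suc i)), (v (Suc i), v i)}"
  obtains es where "simple_path G es" "S \<subseteq> set es"
proof -
  obtain H where H: "multipath G H" "F = arcs H" using F by (auto simp: multipath_complex_def)
  then have HG: "subgraph H G" by (auto simp: multipath_def)
  then have eq: "tail H = tail G" "head H = head G" by (auto simp: subgraph_def compatible_def)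
  interpret H: fin_digraph H using HG by (rule fin_digraph_subgraph)
  define K where "K = \<lparr>verts = tail G ` S \<union> head G ` S, arcs = S, tail = tail G, head = head G\<rparr>"
  have wf: "wf_digraph K" by unfold_locales (auto simp: K_def)
  have KH: "subgraph K H"
  proof (rule subgraphI)
    show "verts K \<subseteq> verts H" using S(1) H(2) H.wellformed eq by (auto simp: K_def)
  qed (use S(1) H(2) wf eq in \<open>auto simp: K_def compatible_def H.wf_digraph_axioms\<close>)
  have "connected K"
    using S(3) adj by (intro connected_trail[OF wf, of v k]) (auto simp: K_def)
  then obtain C where C: "H.max_subgraph connected C" "subgraph K C"
    using H.ex_max_connected_supergraph KH by blast
  have "S \<subseteq> arcs C" using C(2) by (simp add: subgraph_def K_def)
  then have "\<not> is_single_vertex C" using S(2) by (auto simp: is_single_vertex_def)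
  then have "is_simple_path C" using H(1) C(1) by (auto simp: multipath_def)
  then obtain es where es: "simple_path C es" "arcs C = set es" by (auto simp: is_simple_path_def)
  have CG: "subgraph C G"
    using C(1) HG subgraph_trans by (auto simp: H.max_subgraph_def)
  then have "tail C = tail G" "head C = head G" "arcs C \<subseteq> arcs G"
    by (auto simp: subgraph_def compatible_def)
  then have "simple_path G es" using es unfolding simple_path_def by auto
  then show thesis using that es \<open>S \<subseteq> arcs C\<close> by auto
qed

lemma face_subset_arcs: "F \<in> multipath_complex G \<Longrightarrow> F \<subseteq> arcs G"
  by (auto simp: multipath_complex_def multipath_def spanning_def)

text \<open>Two arcs with a common source or target form a connected set, so they lie on one simple
  path, where neither sources nor targets repeat.\<close>

lemma face_degree_le_1:
  assumes F: "F \<in> multipath_complex G" and ef: "e \<in> F" "f \<in> F"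
    and share: "tail G e = tail G f \<or> head G e = head G f"
  shows "e = f"
proof -
  \<comment> \<open>The shared end point stands in the middle; \<open>e\<close> gives the first step
    of \<open>w\<close> and \<open>f\<close> the second.\<close>
  define w where "w = (if tail G e = tail G f then [head G e, tail G e, head G f]
    else [tail G e, head G e, tail G f])"
  have w: "{tail G e, tail G f, head G e, head G f} = (!) w ` {..2}"
    using share by (auto simp: w_def atMost_Suc numeral_2_eq_2)
  have adj: "\<exists>g\<in>{e, f}. (tail G g, head G g) \<in> {(w ! i, w ! Suc i), (w ! Suc i, w ! i)}"
    if "i < 2" for i
    using share that by (auto simp: w_def less_2_cases_iff)
  have ends: "tail G ` {e, f} \<union> head G ` {e, f} = (!) w ` {..2}"
    unfolding w[symmetric] by auto
  obtain es where es: "simple_path G es" "{e, f} \<subseteq> set es"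
    by (rule connected_arcs_in_simple_path[OF F _ _ ends adj]) (use ef in auto)
  then show ?thesis using share unfolding simple_path_def
    by (metis in_set_conv_nth insert_subset)
qed

text \<open>If every source in \<open>S\<close> were a target in \<open>S\<close>, the arc of
  \<open>S\<close> with least index would have a predecessor in \<open>S\<close>, which is possible
  only if the path closes up into a cycle.\<close>

lemma simple_path_acyclic:
  assumes es: "simple_path G es" and S: "S \<subseteq> set es" "S \<noteq> {}"
  shows "\<not> tail G ` S \<subseteq> head G ` S"
proof
  assume cyc: "tail G ` S \<subseteq> head G ` S"
  have succ: "tail G (es ! Suc i) = head G (es ! i)" if "Suc i < length es" for i
    using es that by (auto simp: simple_path_def)
  have inj: "i = j" if "i < length es" "j < length es"
    "tail G (es ! i) = tail G (es ! j) \<or> head G (es ! i) = head G (es ! j)" for i j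
    using es that unfolding simple_path_def by blast
  let ?P = "\<lambda>i. i < length es \<and> es ! i \<in> S"
  have "\<exists>i. ?P i" using S by (metis in_set_conv_nth all_not_in_conv subsetD)
  define i where "i = (LEAST i. ?P i)"
  have i: "?P i" and least: "\<And>j. ?P j \<Longrightarrow> i \<le> j"
    unfolding i_def using LeastI_ex[OF \<open>\<exists>i. ?P i\<close>] Least_le[of ?P] by auto
  obtain e where e: "e \<in> S" "head G e = tail G (es ! i)"
    using i cyc by (metis imageE imageI subsetD)
  then obtain j where j: "j < length es" "e = es ! j"
    using S by (metis in_set_conv_nth subsetD)
  have "i \<le> j" using least j e by simp
  \<comment> \<open>A successor of \<open>es ! j\<close> would share its source with
    \<open>es ! i\<close>, forcing \<open>Suc j = i\<close> against
    \<open>i \<le> j\<close>.\<close>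
  have last: "\<not> Suc j < length es"
  proof
    assume "Suc j < length es"
    then have "tail G (es ! Suc j) = tail G (es ! i)" using succ e(2) j(2) by metis
    then have "Suc j = i" using inj \<open>Suc j < length es\<close> i by blast
    then show False using \<open>i \<le> j\<close> by simp
  qed
  have "i = 0"
  proof (cases i)
    case (Suc i')
    then have "head G (es ! i') = head G (es ! j)" using succ i e(2) j(2) by metis
    then have "i' = j" using inj[of i' j] i j(1) Suc by simp
    then show ?thesis using \<open>i \<le> j\<close> Suc by simp
  qed
  moreover have "j = length es - 1" using last j by simp
  ultimately have "tail G (hd es) = head G (last es)"
    using e(2) j by (metis hd_conv_nth last_conv_nth list.size(3) not_less_zero)
  then show False using es by (simp add: simple_path_def)
qed

text \<open>The trail makes \<open>S\<close> connected, so a face containing it would put it on one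
  simple path; \<open>cyc\<close> then contradicts \<open>simple_path_acyclic\<close>.\<close>

lemma face_no_closed_trail:
  assumes F: "F \<in> multipath_complex G"
    and S: "S \<noteq> {}" "tail G ` S \<union> head G ` S = v ` {..k::nat}"
    and adj: "\<And>i. i < k \<Longrightarrow> \<exists>e\<in>S. (tail G e, head G e) \<in> {(v i, v (Suc i)), (v (Suc i), v i)}"
    and cyc: "tail G ` S \<subseteq> head G ` S"
  shows "\<not> S \<subseteq> F"
proof
  assume "S \<subseteq> F"
  then obtain es where "simple_path G es" "S \<subseteq> set es"
    using connected_arcs_in_simple_path[OF F, of S v k] S adj by metis
  then show False using simple_path_acyclic S(1) cyc by blast
qed

end

text \<open>The spanning subgraph with these arcs is connected, so it is its own only component, and
  that component is a simple path; \<open>0 < n\<close> provides an arc.\<close>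

lemma hamiltonian_path_is_face:
  assumes "wf_digraph G" and n: "0 < n" and v: "inj_on v {..n::nat}" "verts G = v ` {..n}"
    and e: "\<And>t. t < n \<Longrightarrow> e t \<in> arcs G \<and> tail G (e t) = v t \<and> head G (e t) = v (Suc t)"
  shows "e ` {..<n} \<in> multipath_complex G"
proof -
  interpret wf_digraph G by fact
  define H where "H = G\<lparr>arcs := e ` {..<n}\<rparr>"
  have wf: "wf_digraph H" using e v(2) by unfold_locales (auto simp: H_def)
  have HG: "subgraph H G" using e wf by (intro subgraphI) (auto simp: H_def compatible_def wf_digraph_axioms)
  have conn: "connected H"
    using v e by (intro connected_trail[OF wf, of v n]) (auto simp: H_def)
  define es where "es = map e [0..<n]"
  have nth: "es ! i = e i" if "i < n" for i using that by (simp add: es_def)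
  have ends: "hd es = e 0" "last es = e (n - 1)"
    using n by (simp_all add: es_def hd_map last_map)
  have inj: "i = j" if "v i = v j" "i \<le> n" "j \<le> n" for i j
    using that v(1) by (auto dest: inj_onD)
  have tl: "tail G (e t) = v t" "head G (e t) = v (Suc t)" if "t < n" for t using e[OF that] by auto
  have "tail G (hd es) \<noteq> head G (last es)"
    using tl[of 0] tl[of "n - 1"] inj[of 0 n] n by (auto simp: ends)
  then have "simple_path H es"
    using n tl inj[of "Suc _" "Suc _"] inj
    unfolding simple_path_def by (auto simp: H_def nth es_def)
  moreover have "verts H = tail H ` set es \<union> head H ` set es"
  proof -
    have "v ` {..n} = v ` {..<n} \<union> v ` Suc ` {..<n}"
    proof -
      have "{..n} = {..<n} \<union> {n}" by auto
      moreover have "n \<in> Suc ` {..<n}" using n by (auto intro!: image_eqI[of _ _ "n - 1"])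
      ultimately have "{..n} = {..<n} \<union> Suc ` {..<n}" by auto
      then show ?thesis by blast
    qed
    then show ?thesis using v(2) tl
      by (auto simp: H_def es_def image_image atLeast0LessThan)
  qed
  ultimately have path: "is_simple_path H"
    unfolding is_simple_path_def by (intro exI[of _ es]) (auto simp: H_def es_def)
  have "C = H" if "pre_digraph.max_subgraph H connected C" for C
    using that conn wf_digraph.subgraph_refl[OF wf] unfolding pre_digraph.max_subgraph_def by metis
  then have "multipath G H"
    using HG path unfolding multipath_def spanning_def by (auto simp: H_def)
  moreover have "e ` {..<n} = arcs H" by (simp add: H_def)
  ultimately show ?thesis unfolding multipath_complex_def by blast
qed

section \<open>The bidirectional polygon\<close>

definition cw :: "nat \<Rightarrow> nat \<Rightarrow> nat \<times> nat" where
  "cw n i = (i, (i + 1) mod (n + 1))"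

text \<open>The index is the target, not the source, so that \<open>ccw n i\<close> reverses
  \<open>cw n i\<close> and both belong to the same side of the polygon.\<close>

definition ccw :: "nat \<Rightarrow> nat \<Rightarrow> nat \<times> nat" where
  "ccw n i = ((i + 1) mod (n + 1), i)"

lemma parcs_BP: "parcs (BP n) = cw n ` {..n} \<union> ccw n ` {..n}"
  by (auto simp: BP_def cw_def ccw_def)

lemma pverts_BP: "pverts (BP n) = {..n}"
  by (auto simp: BP_def)

lemma Suc_mod_Suc: "i \<le> n \<Longrightarrow> Suc i mod Suc n = (if i = n then 0 else Suc i)"
  by simp

lemma fin_digraph_BP: "fin_digraph (with_proj (BP n))"
  by unfold_locales (auto simp: parcs_BP pverts_BP cw_def ccw_def)

section \<open>Cyclic order of the vertices and the two families of Hamiltonian paths\<close>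

text \<open>The vertices in cyclic order, starting after \<open>k\<close>.\<close>

definition rot :: "nat \<Rightarrow> nat \<Rightarrow> nat \<Rightarrow> nat" where
  "rot n k t = (if k + t < n then k + t + 1 else k + t - n)"

text \<open>For \<open>k\<close> and \<open>t\<close> at most \<open>n\<close>,
  \<open>rot n k t\<close> is \<open>(k + t + 1) mod (n + 1)\<close>; the case form leaves
  injectivity to linear arithmetic.\<close>

lemma inj_on_rot: "k \<le> n \<Longrightarrow> inj_on (rot n k) {..n}"
  by (auto simp: inj_on_def rot_def split: if_splits)

lemma rot_image: assumes "k \<le> n" shows "rot n k ` {..n} = {..n}"
proof (rule card_subset_eq)
  show "rot n k ` {..n} \<subseteq> {..n}" using assms by (auto simp: rot_def)
qed (use card_image[OF inj_on_rot[OF assms]] in auto)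

text \<open>The order that starts after \<open>k\<close> ends at \<open>k\<close>, so dropping its
  last position drops exactly \<open>k\<close>.\<close>

lemma rot_image_lessThan: assumes "k \<le> n" shows "rot n k ` {..<n} = {..n} - {k}"
proof -
  have "rot n k ` ({..n} - {n}) = rot n k ` {..n} - rot n k ` {n}"
    using assms by (intro inj_on_image_set_diff[OF inj_on_rot]) auto
  moreover have "{..n} - {n} = {..<n}" by auto
  moreover have "rot n k n = k" using assms by (simp add: rot_def)
  ultimately show ?thesis using rot_image[OF assms] by simp
qed

lemma rot_Suc:
  assumes "k \<le> n" "t < n" shows "(rot n k t + 1) mod (n + 1) = rot n k (Suc t)"
proof -
  have "rot n k t \<le> n" using assms by (auto simp: rot_def)
  then show ?thesis using assms by (auto simp: rot_def Suc_mod_Suc)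
qed

lemma inj_cw: "inj (cw n)" and inj_ccw: "inj (ccw n)"
  by (auto simp: inj_def cw_def ccw_def)

lemma cw_punctured_face:
  assumes "k \<le> n" "0 < n"
  shows "cw n ` {..n} - {cw n k} \<in> multipath_complex (with_proj (BP n))"
proof -
  interpret fin_digraph "with_proj (BP n)" by (rule fin_digraph_BP)
  have "(\<lambda>t. cw n (rot n k t)) ` {..<n} \<in> multipath_complex (with_proj (BP n))"
  proof (rule hamiltonian_path_is_face[OF wf_digraph_axioms, of n "rot n k"])
    fix t assume t: "t < n"
    then have "rot n k t \<le> n" using rot_image[OF assms(1)] by auto
    then show "cw n (rot n k t) \<in> arcs (with_proj (BP n)) \<and>
        tail (with_proj (BP n)) (cw n (rot n k t)) = rot n k t \<and>
        head (with_proj (BP n)) (cw n (rot n k t)) = rot n k (Suc t)"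
      using rot_Suc[OF assms(1) t] by (auto simp: parcs_BP cw_def)
  qed (use assms in \<open>auto simp: inj_on_rot rot_image pverts_BP\<close>)
  moreover have "(\<lambda>t. cw n (rot n k t)) ` {..<n} = cw n ` rot n k ` {..<n}" by auto
  ultimately show ?thesis using rot_image_lessThan[OF assms(1)] inj_cw[of n]
    by (simp add: image_set_diff)
qed

text \<open>The remaining path runs through the order \<open>rot n k\<close> backwards, from
  \<open>k\<close> to the cyclic successor of \<open>k\<close>.\<close>

lemma ccw_punctured_face:
  assumes "k \<le> n" "0 < n"
  shows "ccw n ` {..n} - {ccw n k} \<in> multipath_complex (with_proj (BP n))"
proof -
  interpret fin_digraph "with_proj (BP n)" by (rule fin_digraph_BP)
  have reflect: "(\<lambda>t. n - t) ` {..n} = {..n}" "(\<lambda>t. n - Suc t) ` {..<n} = {..<n}"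
  proof -
    have "x \<in> (\<lambda>t. n - t) ` {..n}" if "x \<le> n" for x
      using that by (intro image_eqI[of _ _ "n - x"]) auto
    then show "(\<lambda>t. n - t) ` {..n} = {..n}" by auto
    have "x \<in> (\<lambda>t. n - Suc t) ` {..<n}" if "x < n" for x
      using that by (intro image_eqI[of _ _ "n - Suc x"]) auto
    then show "(\<lambda>t. n - Suc t) ` {..<n} = {..<n}" by auto
  qed
  \<comment> \<open>Step \<open>t\<close> goes from \<open>rot n k (n - t)\<close> to
    \<open>rot n k (n - Suc t)\<close>; the latter is the index because \<open>ccw\<close> is
    indexed by targets.\<close>
  have "(\<lambda>t. ccw n (rot n k (n - Suc t))) ` {..<n} \<in> multipath_complex (with_proj (BP n))"
  proof (rule hamiltonian_path_is_face[OF wf_digraph_axioms, of n "\<lambda>t. rot n k (n - t)"])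
    show "inj_on (\<lambda>t. rot n k (n - t)) {..n}"
      using inj_on_rot[OF assms(1)] unfolding inj_on_def
      by (metis atMost_iff diff_diff_cancel diff_le_self)
    show "verts (with_proj (BP n)) = (\<lambda>t. rot n k (n - t)) ` {..n}"
      using rot_image[OF assms(1)] reflect(1) image_image[of "rot n k" "\<lambda>t. n - t" "{..n}"]
      by (simp add: pverts_BP)
    fix t assume t: "t < n"
    then have "rot n k (n - Suc t) \<le> n" using rot_image[OF assms(1)] by auto
    then have "ccw n (rot n k (n - Suc t)) \<in> parcs (BP n)" by (simp add: parcs_BP)
    then show "ccw n (rot n k (n - Suc t)) \<in> arcs (with_proj (BP n)) \<and>
        tail (with_proj (BP n)) (ccw n (rot n k (n - Suc t))) = rot n k (n - t) \<and>
        head (with_proj (BP n)) (ccw n (rot n k (n - Suc t))) = rot n k (n - Suc t)"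
      using rot_Suc[OF assms(1), of "n - Suc t"] t by (simp add: ccw_def Suc_diff_Suc)
  qed (use assms in auto)
  moreover have "(\<lambda>t. ccw n (rot n k (n - Suc t))) ` {..<n} = ccw n ` rot n k ` {..<n}"
    using reflect(2) by (metis (no_types, lifting) image_cong image_image)
  ultimately show ?thesis using rot_image_lessThan[OF assms(1)] inj_ccw[of n]
    by (simp add: image_set_diff)
qed

section \<open>Arc sets excluded from the faces for the polygon\<close>

lemma cycle_not_in_face:
  assumes F: "F \<in> multipath_complex (with_proj (BP n))"
  shows "\<not> cw n ` {..n} \<subseteq> F" "\<not> ccw n ` {..n} \<subseteq> F"
proof -
  interpret fin_digraph "with_proj (BP n)" by (rule fin_digraph_BP)
  \<comment> \<open>The successor map on the vertices is \<open>rot n 0\<close>, a permutation;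
    hence every vertex is both a source and a target in each cycle.\<close>
  have im: "(\<lambda>i. (i + 1) mod (n + 1)) ` {..n} = {..n}"
  proof -
    have "(\<lambda>i. (i + 1) mod (n + 1)) ` {..n} = rot n 0 ` {..n}"
      by (intro image_cong) (auto simp: rot_def)
    then show ?thesis by (simp add: rot_image)
  qed
  have ends: "fst ` cw n ` {..n} = {..n}" "snd ` cw n ` {..n} = {..n}"
    "fst ` ccw n ` {..n} = {..n}" "snd ` ccw n ` {..n} = {..n}"
    using im by (simp_all add: cw_def ccw_def image_image)
  have step: "\<exists>e\<in>cw n ` {..n}. (fst e, snd e) = (i, Suc i)"
    "\<exists>e\<in>ccw n ` {..n}. (fst e, snd e) = (Suc i, i)" if "i < n" for i
  proof -
    show "\<exists>e\<in>cw n ` {..n}. (fst e, snd e) = (i, Suc i)"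
      using that by (intro bexI[of _ "cw n i"], simp add: cw_def) simp
    show "\<exists>e\<in>ccw n ` {..n}. (fst e, snd e) = (Suc i, i)"
      using that by (intro bexI[of _ "ccw n i"], simp add: ccw_def) simp
  qed
  \<comment> \<open>The steps \<open>0, 1, ..., n\<close> connect the cycle, and \<open>ends\<close>
    shows that every source is a target.\<close>
  show "\<not> cw n ` {..n} \<subseteq> F"
    by (rule face_no_closed_trail[OF F, where v = "\<lambda>i. i" and k = n])
      (use ends step(1) in \<open>fastforce+\<close>)
  show "\<not> ccw n ` {..n} \<subseteq> F"
    by (rule face_no_closed_trail[OF F, where v = "\<lambda>i. i" and k = n])
      (use ends step(2) in \<open>fastforce+\<close>)
qed

text \<open>Equality would make \<open>i\<close> and \<open>j\<close> successors of each other
  modulo \<open>n + 1\<close>, so \<open>n + 1\<close> would divide 2; with at least three vertices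
  this fails.\<close>

lemma cw_neq_ccw:
  assumes "n \<ge> 2" "i \<le> n" "j \<le> n" shows "cw n i \<noteq> ccw n j"
proof
  assume "cw n i = ccw n j"
  then have "i = Suc j mod Suc n" "j = Suc i mod Suc n" by (auto simp: cw_def ccw_def)
  then have "i = (if j = n then 0 else Suc j)" "j = (if i = n then 0 else Suc i)"
    using Suc_mod_Suc[OF assms(2)] Suc_mod_Suc[OF assms(3)] by argo+
  then show False using assms(1) by presburger
qed

text \<open>Equal indices give two opposite arcs, a closed trail of length two. In the other two
  cases the arcs share a target or a source, while \<open>cw_neq_ccw\<close> keeps them
  distinct.\<close>

lemma opposite_arcs_in_face:
  assumes n: "n \<ge> 2" and F: "F \<in> multipath_complex (with_proj (BP n))"
    and ij: "i \<le> n" "j \<le> n" "cw n i \<in> F" "ccw n j \<in> F"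
  shows "i \<noteq> j" "(i + 1) mod (n + 1) \<noteq> j" "(j + 1) mod (n + 1) \<noteq> i"
proof -
  interpret fin_digraph "with_proj (BP n)" by (rule fin_digraph_BP)
  have "\<not> {cw n i, ccw n i} \<subseteq> F"
    by (rule face_no_closed_trail[OF F, where v = "\<lambda>t. if t = 0 then i else (i + 1) mod (n + 1)" and k = 1])
      (auto simp: cw_def ccw_def atMost_Suc)
  then show "i \<noteq> j" using ij by auto
  have "cw n i \<noteq> ccw n j" using n ij(1,2) by (rule cw_neq_ccw)
  then have "snd (cw n i) \<noteq> snd (ccw n j)" "fst (ccw n j) \<noteq> fst (cw n i)"
    using face_degree_le_1[OF F ij(3,4)] by auto
  then show "(i + 1) mod (n + 1) \<noteq> j" "(j + 1) mod (n + 1) \<noteq> i"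
    by (simp_all add: cw_def ccw_def)
qed

text \<open>The indices \<open>i\<close>, its successor \<open>s\<close> and its predecessor
  \<open>p\<close> are distinct because \<open>n + 1 \<ge> 3\<close>, and all are excluded. The
  condition \<open>excl\<close> is symmetric in \<open>i\<close> and \<open>j\<close>, so the lemma
  serves both directions.\<close>

lemma three_neighbours:
  fixes n i :: nat
  assumes "n \<ge> 2" "i \<le> n" "inj e" "e ` {..n} \<subseteq> B" "finite B"
    and excl: "\<And>j. j \<le> n \<Longrightarrow> e j \<in> F \<Longrightarrow>
      i \<noteq> j \<and> (i + 1) mod (n + 1) \<noteq> j \<and> (j + 1) mod (n + 1) \<noteq> i"
  shows "3 \<le> card (B - F)"
proof -
  define s where "s = (if i = n then 0 else i + 1)"
  define p where "p = (if i = 0 then n else i - 1)"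
  have le: "s \<le> n" "p \<le> n" and dist: "i \<noteq> s" "i \<noteq> p" "s \<noteq> p"
    using assms(1,2) by (auto simp: s_def p_def)
  have sp: "(i + 1) mod (n + 1) = s" "(p + 1) mod (n + 1) = i"
    using assms(1,2) by (auto simp: s_def p_def)
  have "e ` {i, s, p} \<subseteq> B - F"
    using excl[of i] excl[of s] excl[of p] sp le assms(2,4) by auto
  moreover have "card (e ` {i, s, p}) = 3"
    using dist inj_on_subset[OF assms(3), of "{i, s, p}"] by (subst card_image) auto
  ultimately show ?thesis using card_mono[of "B - F" "e ` {i, s, p}"] assms(5) by simp
qed

theorem proposition3p1:
  fixes n :: nat
  assumes "n \<ge> 2"
  shows "\<not> shellable (multipath_complex (with_proj (BP n)))"
proof (rule not_shellable_two_spheres[of "cw n ` {..n}" "ccw n ` {..n}"])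
  interpret fin_digraph "with_proj (BP n)" by (rule fin_digraph_BP)
  show "2 \<le> card (cw n ` {..n})" "2 \<le> card (ccw n ` {..n})"
    using assms inj_on_subset[OF inj_cw, of _ n] inj_on_subset[OF inj_ccw, of _ n]
    by (simp_all add: card_image)
  show "cw n ` {..n} \<inter> ccw n ` {..n} = {}"
    using cw_neq_ccw[OF assms] by blast
  show "cw n ` {..n} - {x} \<in> multipath_complex (with_proj (BP n))" if "x \<in> cw n ` {..n}" for x
    using that cw_punctured_face assms by auto
  show "ccw n ` {..n} - {x} \<in> multipath_complex (with_proj (BP n))" if "x \<in> ccw n ` {..n}" for x
    using that ccw_punctured_face assms by auto
  fix F assume F: "F \<in> multipath_complex (with_proj (BP n))"
  show "F \<subseteq> cw n ` {..n} \<union> ccw n ` {..n} \<and> \<not> cw n ` {..n} \<subseteq> F \<and> \<not> ccw n ` {..n} \<subseteq> F"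
    using face_subset_arcs[OF F] cycle_not_in_face[OF F] by (simp add: parcs_BP)
  show "3 \<le> card (ccw n ` {..n} - F)" if "F \<inter> cw n ` {..n} \<noteq> {}"
  proof -
    obtain i where "i \<le> n" "cw n i \<in> F" using \<open>F \<inter> cw n ` {..n} \<noteq> {}\<close> by auto
    then show ?thesis
      using opposite_arcs_in_face[OF assms F, of i]
      by (intro three_neighbours[OF assms, of i "ccw n"]) (auto simp: inj_ccw)
  qed
  show "3 \<le> card (cw n ` {..n} - F)" if "F \<inter> ccw n ` {..n} \<noteq> {}"
  proof -
    obtain i where "i \<le> n" "ccw n i \<in> F" using \<open>F \<inter> ccw n ` {..n} \<noteq> {}\<close> by auto
    then show ?thesis
      using opposite_arcs_in_face[OF assms F, of _ i]
      by (intro three_neighbours[OF assms, of i "cw n"]) (auto simp: inj_cw)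
  qed
qed simp_all

end
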